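(* Let $L : (\mathcal{BT}\otimes\mathcal{BT})\otimes(\mathcal{BT}\otimes\mathcal{BT})\to \mathcal{BT}\otimes\mathcal{BT}$ be the $\mathbb{K}$-linear map $$L\big((x\otimes y)\otimes(z\otimes t)\big)=B(x\otimes z)\otimes\varepsilon(yt)\,1 + xz\otimes B(y\otimes t).$$ Let $\Delta:\mathcal{BT}\to\mathcal{BT}\otimes\mathcal{BT}$ be the unique morphism of unital algebras such that $\Delta\circ B=L\circ(\Delta\otimes\Delta)$. Equipped with this coproduct $\Delta$ (and its concatenation product, graded by the number of vertices), $\mathcal{BT}$ is a graded connected Hopf algebra.
   Context: $\mathbb{K}$ is a commutative field of any characteristic. We consider planar rooted forests (finite ordered sequences of planar rooted trees) whose edges are decorated by $l$ or $r$; the degree $|F|$ of a forest $F$ is its number of vertices, and $1$ is the empty forest. For two such forests $F,G$, $B(F\otimes G)$ is the tree obtained by grafting the roots of the trees of $F$ followed by those of $G$ (in this left-to-right order) on a common new root, the edges from the new root to the roots of $F$ being decorated by $l$ and those to the roots of $G$ by $r$. In particular $B(1\otimes 1)=\bullet$, the tree with one vertex. Let $\mathbb{T}$ be the set consisting of $1$ and of the trees obtained inductively as $B(F_1\cdots F_p\otimes G_1\cdots G_q)$, $p,q\ge 0$, with all $F_i,G_j$ nonempty trees already in $\mathbb{T}$; $\mathbb{F}$ is the set of forests all of whose trees are in $\mathbb{T}$ (including $1$). $\mathcal{BT}$ is the $\mathbb{K}$-vector space with basis $\mathbb{F}$, a unital associative algebra for the concatenation of forests; $B$ is extended linearly to $B:\mathcal{BT}\otimes\mathcal{BT}\to\mathcal{BT}$.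 The map $\varepsilon:\mathcal{BT}\to\mathbb{K}$ is the linear map with $\varepsilon(F)=\delta_{F,1}$ for $F\in\mathbb{F}$. (For every unital algebra $A$ and linear map $L:A\otimes A\to A$ there is a unique algebra morphism $\phi:\mathcal{BT}\to A$ with $\phi\circ B=L\circ(\phi\otimes\phi)$, so $\Delta$ is well defined.) *)

theory Defs
  imports Complex_Main "HOL-Library.Poly_Mapping"
begin

section \<open>Vector spaces with a distinguished basis\<close>

text \<open>
  The vector space with basis \<open>'b\<close> over the field \<open>'k\<close> is the type \<open>'b \<Rightarrow>\<^sub>0 'k\<close> of finitely
  supported functions. The tensor product of the spaces with bases \<open>'a\<close> and \<open>'b\<close> is the space with
  basis \<open>'a \<times> 'b\<close>, where \<open>bv (a, b)\<close> stands for \<open>bv a \<otimes> bv b\<close>.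
\<close>

definition scale :: "'k::field \<Rightarrow> ('b \<Rightarrow>\<^sub>0 'k) \<Rightarrow> ('b \<Rightarrow>\<^sub>0 'k)" where
  "scale c x = Poly_Mapping.map ((*) c) x"

lemma lookup_scale [simp]: "Poly_Mapping.lookup (scale c x) b = c * Poly_Mapping.lookup x b"
  unfolding scale_def by (simp add: Poly_Mapping.map.rep_eq when_def)

global_interpretation pm: vector_space "scale :: 'k::field \<Rightarrow> ('b \<Rightarrow>\<^sub>0 'k) \<Rightarrow> _"
  by unfold_locales (simp_all add: poly_mapping_eq_iff fun_eq_iff lookup_add algebra_simps)

abbreviation bv :: "'b \<Rightarrow> ('b \<Rightarrow>\<^sub>0 'k::field)" where
  "bv b \<equiv> Poly_Mapping.single b 1"

definition lin_ext :: "('a \<Rightarrow> ('b \<Rightarrow>\<^sub>0 'k)) \<Rightarrow> ('a \<Rightarrow>\<^sub>0 'k::field) \<Rightarrow> ('b \<Rightarrow>\<^sub>0 'k)" where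
  "lin_ext f x = (\<Sum>a\<in>Poly_Mapping.keys x. scale (Poly_Mapping.lookup x a) (f a))"

lemma lin_ext_superset:
  assumes "finite A" "Poly_Mapping.keys x \<subseteq> A"
  shows "lin_ext f x = (\<Sum>a\<in>A. scale (Poly_Mapping.lookup x a) (f a))"
  unfolding lin_ext_def
  by (rule sum.mono_neutral_left) (use assms in \<open>auto simp: in_keys_iff\<close>)

lemma lin_ext_add [simp]: "lin_ext f (x + y) = lin_ext f x + lin_ext f y"
  using lin_ext_superset[of "Poly_Mapping.keys x \<union> Poly_Mapping.keys y" x f]
    lin_ext_superset[of "Poly_Mapping.keys x \<union> Poly_Mapping.keys y" y f]
    lin_ext_superset[of "Poly_Mapping.keys x \<union> Poly_Mapping.keys y" "x + y" f]
    Poly_Mapping.keys_add[of x y]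
  by (simp add: lookup_add pm.scale_left_distrib sum.distrib)

lemma lin_ext_scale [simp]: "lin_ext f (scale c x) = scale c (lin_ext f x)"
proof -
  have "Poly_Mapping.keys (scale c x) \<subseteq> Poly_Mapping.keys x"
    by (auto simp: in_keys_iff)
  then show ?thesis
    using lin_ext_superset[of "Poly_Mapping.keys x" "scale c x" f]
    by (simp add: lin_ext_def pm.scale_sum_right)
qed

lemma lin_ext_zero [simp]: "lin_ext f 0 = 0"
  by (simp add: lin_ext_def)

lemma lin_ext_bv [simp]: "lin_ext f (bv b) = f b"
  by (simp add: lin_ext_def)

lemma linear_lin_ext: "Vector_Spaces.linear scale scale (lin_ext f)"
  by (simp add: Vector_Spaces.linear_def module_hom_axioms_def module_hom_def pm.vector_space_axioms pm.module_axioms)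

lemma lin_ext_fun_add [simp]: "lin_ext (\<lambda>a. f a + g a) x = lin_ext f x + lin_ext g x"
  by (simp add: lin_ext_def pm.scale_right_distrib sum.distrib)

lemma lin_ext_fun_scale [simp]: "lin_ext (\<lambda>a. scale c (f a)) x = scale c (lin_ext f x)"
  by (simp add: lin_ext_def pm.scale_sum_right mult.commute)

lemma lin_ext_fun_zero [simp]: "lin_ext (\<lambda>a. 0) x = 0"
  by (simp add: lin_ext_def)

lemma bv_induct [case_names zero add scale bv]:
  assumes "P 0" "\<And>x y. P x \<Longrightarrow> P y \<Longrightarrow> P (x + y)" "\<And>c x. P x \<Longrightarrow> P (scale c x)" "\<And>b. P (bv b)"
  shows "P x"
proof -
  have "lin_ext bv x = x"
    by (simp add: poly_mapping_eq_iff fun_eq_iff lin_ext_def lookup_sum lookup_single when_def in_keys_iff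
        if_distrib[of "(*) _"] sum.delta cong: if_cong)
  moreover have "P (\<Sum>a\<in>A. scale (Poly_Mapping.lookup x a) (bv a))" if "finite A" for A
    using that by (induction A rule: finite_induct) (simp_all add: assms)
  ultimately show ?thesis
    unfolding lin_ext_def by (metis finite_keys)
qed

definition tensor :: "('a \<Rightarrow>\<^sub>0 'k) \<Rightarrow> ('b \<Rightarrow>\<^sub>0 'k) \<Rightarrow> ('a \<times> 'b \<Rightarrow>\<^sub>0 'k::field)"
    (infixr "\<otimes>" 75) where
  "x \<otimes> y = lin_ext (\<lambda>a. lin_ext (\<lambda>b. bv (a, b)) y) x"

lemma tensor_simps [simp]:
  "(x + x') \<otimes> y = x \<otimes> y + x' \<otimes> y" "x \<otimes> (y + y') = x \<otimes> y + x \<otimes> y'"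
  "scale c x \<otimes> y = scale c (x \<otimes> y)" "x \<otimes> scale c y = scale c (x \<otimes> y)"
  "0 \<otimes> y = 0" "x \<otimes> 0 = 0" "bv a \<otimes> bv b = bv (a, b)"
  by (simp_all add: tensor_def)

definition tensor_map ::
    "(('a \<Rightarrow>\<^sub>0 'k) \<Rightarrow> ('c \<Rightarrow>\<^sub>0 'k)) \<Rightarrow> (('b \<Rightarrow>\<^sub>0 'k) \<Rightarrow> ('d \<Rightarrow>\<^sub>0 'k))
      \<Rightarrow> ('a \<times> 'b \<Rightarrow>\<^sub>0 'k::field) \<Rightarrow> ('c \<times> 'd \<Rightarrow>\<^sub>0 'k)" where
  "tensor_map f g = lin_ext (\<lambda>(a, b). f (bv a) \<otimes> g (bv b))"

definition tensor_assoc :: "(('a \<times> 'b) \<times> 'c \<Rightarrow>\<^sub>0 'k::field) \<Rightarrow> ('a \<times> 'b \<times> 'c \<Rightarrow>\<^sub>0 'k)" where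
  "tensor_assoc = lin_ext (\<lambda>((a, b), c). bv (a, b, c))"

text \<open>
  \<open>\<epsilon> \<otimes> id\<close> and \<open>id \<otimes> \<epsilon>\<close> for a linear form \<open>\<epsilon>\<close>, after the identifications of \<open>K \<otimes> V\<close> and \<open>V \<otimes> K\<close>
  with \<open>V\<close>.
\<close>

definition form_left :: "(('a \<Rightarrow>\<^sub>0 'k) \<Rightarrow> 'k) \<Rightarrow> ('a \<times> 'b \<Rightarrow>\<^sub>0 'k::field) \<Rightarrow> ('b \<Rightarrow>\<^sub>0 'k)" where
  "form_left \<epsilon> = lin_ext (\<lambda>(a, b). scale (\<epsilon> (bv a)) (bv b))"

definition form_right :: "(('b \<Rightarrow>\<^sub>0 'k) \<Rightarrow> 'k) \<Rightarrow> ('a \<times> 'b \<Rightarrow>\<^sub>0 'k::field) \<Rightarrow> ('a \<Rightarrow>\<^sub>0 'k)" where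
  "form_right \<epsilon> = lin_ext (\<lambda>(a, b). scale (\<epsilon> (bv b)) (bv a))"


section \<open>Hopf algebras\<close>

text \<open>The product is a bilinear map; \<open>mult_map\<close> is the induced linear map on the tensor square.\<close>

definition mult_map ::
    "(('b \<Rightarrow>\<^sub>0 'k) \<Rightarrow> ('b \<Rightarrow>\<^sub>0 'k) \<Rightarrow> ('b \<Rightarrow>\<^sub>0 'k)) \<Rightarrow> ('b \<times> 'b \<Rightarrow>\<^sub>0 'k::field) \<Rightarrow> ('b \<Rightarrow>\<^sub>0 'k)" where
  "mult_map mult = lin_ext (\<lambda>(a, b). mult (bv a) (bv b))"

definition tensor_mult ::
    "(('b \<Rightarrow>\<^sub>0 'k) \<Rightarrow> ('b \<Rightarrow>\<^sub>0 'k) \<Rightarrow> ('b \<Rightarrow>\<^sub>0 'k))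
      \<Rightarrow> ('b \<times> 'b \<Rightarrow>\<^sub>0 'k::field) \<Rightarrow> ('b \<times> 'b \<Rightarrow>\<^sub>0 'k) \<Rightarrow> ('b \<times> 'b \<Rightarrow>\<^sub>0 'k)" where
  "tensor_mult mult u v =
     lin_ext (\<lambda>(a, b). lin_ext (\<lambda>(c, d). mult (bv a) (bv c) \<otimes> mult (bv b) (bv d)) v) u"

definition algebra_morphism ::
    "(('a \<Rightarrow>\<^sub>0 'k) \<Rightarrow> ('a \<Rightarrow>\<^sub>0 'k) \<Rightarrow> ('a \<Rightarrow>\<^sub>0 'k)) \<Rightarrow> ('a \<Rightarrow>\<^sub>0 'k)
      \<Rightarrow> (('b \<Rightarrow>\<^sub>0 'k) \<Rightarrow> ('b \<Rightarrow>\<^sub>0 'k) \<Rightarrow> ('b \<Rightarrow>\<^sub>0 'k)) \<Rightarrow> ('b \<Rightarrow>\<^sub>0 'k)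
      \<Rightarrow> (('a \<Rightarrow>\<^sub>0 'k::field) \<Rightarrow> ('b \<Rightarrow>\<^sub>0 'k)) \<Rightarrow> bool" where
  "algebra_morphism mult1 one1 mult2 one2 f \<longleftrightarrow>
     Vector_Spaces.linear scale scale f \<and> f one1 = one2 \<and>
     (\<forall>x y. f (mult1 x y) = mult2 (f x) (f y))"

locale unital_algebra =
  fixes mult :: "('b \<Rightarrow>\<^sub>0 'k::field) \<Rightarrow> ('b \<Rightarrow>\<^sub>0 'k) \<Rightarrow> ('b \<Rightarrow>\<^sub>0 'k)"
    and one :: "'b \<Rightarrow>\<^sub>0 'k"
  assumes mult_linear_right: "Vector_Spaces.linear scale scale (mult x)"
    and mult_linear_left: "Vector_Spaces.linear scale scale (\<lambda>x. mult x y)"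
    and mult_assoc: "mult (mult x y) z = mult x (mult y z)"
    and one_left: "mult one x = x"
    and one_right: "mult x one = x"

locale counital_coalgebra =
  fixes \<Delta> :: "('b \<Rightarrow>\<^sub>0 'k::field) \<Rightarrow> ('b \<times> 'b \<Rightarrow>\<^sub>0 'k)"
    and \<epsilon> :: "('b \<Rightarrow>\<^sub>0 'k) \<Rightarrow> 'k"
  assumes comult_linear: "Vector_Spaces.linear scale scale \<Delta>"
    and counit_linear: "Vector_Spaces.linear scale (*) \<epsilon>"
    and coassoc: "tensor_assoc (tensor_map \<Delta> id (\<Delta> x)) = tensor_map id \<Delta> (\<Delta> x)"
    and counit_left: "form_left \<epsilon> (\<Delta> x) = x"
    and counit_right: "form_right \<epsilon> (\<Delta> x) = x"

locale bialgebra =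
  unital_algebra mult one + counital_coalgebra \<Delta> \<epsilon>
  for mult :: "('b \<Rightarrow>\<^sub>0 'k::field) \<Rightarrow> ('b \<Rightarrow>\<^sub>0 'k) \<Rightarrow> ('b \<Rightarrow>\<^sub>0 'k)"
    and one :: "'b \<Rightarrow>\<^sub>0 'k"
    and \<Delta> :: "('b \<Rightarrow>\<^sub>0 'k) \<Rightarrow> ('b \<times> 'b \<Rightarrow>\<^sub>0 'k)"
    and \<epsilon> :: "('b \<Rightarrow>\<^sub>0 'k) \<Rightarrow> 'k" +
  assumes comult_morphism: "algebra_morphism mult one (tensor_mult mult) (one \<otimes> one) \<Delta>"
    and counit_one: "\<epsilon> one = 1"
    and counit_mult: "\<epsilon> (mult x y) = \<epsilon> x * \<epsilon> y"
begin

definition antipode :: "(('b \<Rightarrow>\<^sub>0 'k) \<Rightarrow> ('b \<Rightarrow>\<^sub>0 'k)) \<Rightarrow> bool" where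
  "antipode S \<longleftrightarrow> Vector_Spaces.linear scale scale S \<and>
     (\<forall>x. mult_map mult (tensor_map S id (\<Delta> x)) = scale (\<epsilon> x) one) \<and>
     (\<forall>x. mult_map mult (tensor_map id S (\<Delta> x)) = scale (\<epsilon> x) one)"

end

locale hopf_algebra = bialgebra +
  assumes antipode_exists: "\<exists>S. antipode S"

text \<open>A vector space grading: \<open>V\<close> is the internal direct sum of the subspaces \<open>V n\<close>.\<close>

definition vs_grading :: "(nat \<Rightarrow> ('b \<Rightarrow>\<^sub>0 'k::field) set) \<Rightarrow> bool" where
  "vs_grading V \<longleftrightarrow> (\<forall>n. pm.subspace (V n)) \<and>
     (\<forall>x. \<exists>!c. (\<forall>n. c n \<in> V n) \<and> finite {n. c n \<noteq> 0} \<and> x = (\<Sum>n | c n \<noteq> 0. c n))"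

locale graded_hopf_algebra =
  hopf_algebra mult one \<Delta> \<epsilon>
  for mult :: "('b \<Rightarrow>\<^sub>0 'k::field) \<Rightarrow> ('b \<Rightarrow>\<^sub>0 'k) \<Rightarrow> ('b \<Rightarrow>\<^sub>0 'k)"
    and one :: "'b \<Rightarrow>\<^sub>0 'k"
    and \<Delta> :: "('b \<Rightarrow>\<^sub>0 'k) \<Rightarrow> ('b \<times> 'b \<Rightarrow>\<^sub>0 'k)"
    and \<epsilon> :: "('b \<Rightarrow>\<^sub>0 'k) \<Rightarrow> 'k" +
  fixes V :: "nat \<Rightarrow> ('b \<Rightarrow>\<^sub>0 'k) set"
  assumes grading: "vs_grading V"
    and one_graded: "one \<in> V 0"
    and mult_graded: "x \<in> V m \<Longrightarrow> y \<in> V n \<Longrightarrow> mult x y \<in> V (m + n)"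
    and counit_graded: "n > 0 \<Longrightarrow> x \<in> V n \<Longrightarrow> \<epsilon> x = 0"
    and comult_graded:
      "x \<in> V n \<Longrightarrow> \<Delta> x \<in> pm.span {y \<otimes> z |y z. \<exists>i j. i + j = n \<and> y \<in> V i \<and> z \<in> V j}"
    and antipode_graded: "\<exists>S. antipode S \<and> (\<forall>n. \<forall>x\<in>V n. S x \<in> V n)"

locale graded_connected_hopf_algebra = graded_hopf_algebra +
  assumes connected: "pm.dim (V 0) = 1"


section \<open>Forests with left and right edges\<close>

datatype side = Lft | Rgt

datatype dtree = Node "(side \<times> dtree) list"

fun vertices :: "dtree \<Rightarrow> nat" where
  "vertices (Node es) = Suc (\<Sum>c\<leftarrow>es. vertices (snd c))"

definition graft_trees :: "dtree list \<Rightarrow> dtree list \<Rightarrow> dtree" where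
  "graft_trees Fs Gs = Node (map (Pair Lft) Fs @ map (Pair Rgt) Gs)"

text \<open>The nonempty elements of the set \<open>T\<close>; the empty forest is represented by the empty list.\<close>

inductive_set TT :: "dtree set" where
  graft: "Fs \<in> lists TT \<Longrightarrow> Gs \<in> lists TT \<Longrightarrow> graft_trees Fs Gs \<in> TT"

typedef forest = "lists TT"
  morphisms trees_of Forest
  by (rule exI[of _ "[]"]) simp

setup_lifting type_definition_forest

definition degree :: "forest \<Rightarrow> nat" where
  "degree F = (\<Sum>t\<leftarrow>trees_of F. vertices t)"

lift_definition graft_forest :: "forest \<Rightarrow> forest \<Rightarrow> forest" is "\<lambda>Fs Gs. [graft_trees Fs Gs]"
  using TT.graft by auto

text \<open>
  Concatenation is written additively, so that the product of the type \<open>forest \<Rightarrow>\<^sub>0 'k\<close> (the monoid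
  algebra of \<open>forest\<close>) is the bilinear extension of concatenation and its \<open>1\<close> is the empty forest.
\<close>

instantiation forest :: monoid_add
begin

lift_definition zero_forest :: forest is "[]"
  by simp

lift_definition plus_forest :: "forest \<Rightarrow> forest \<Rightarrow> forest" is "(@)"
  by simp

instance
  by standard (transfer; simp)+

end

lemma single_forest_mult: "bv F * bv G = (bv (F + G) :: forest \<Rightarrow>\<^sub>0 'k::field)"
  by (simp add: mult_single)

lemma one_eq_empty_forest: "(1 :: forest \<Rightarrow>\<^sub>0 'k::field) = bv 0"
  by simp


section \<open>The Hopf algebra structure\<close>

definition B :: "(forest \<times> forest \<Rightarrow>\<^sub>0 'k::field) \<Rightarrow> (forest \<Rightarrow>\<^sub>0 'k)" where
  "B = lin_ext (\<lambda>(F, G). bv (graft_forest F G))"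

definition counit :: "(forest \<Rightarrow>\<^sub>0 'k::field) \<Rightarrow> 'k" where
  "counit x = (\<Sum>F\<in>Poly_Mapping.keys x. Poly_Mapping.lookup x F * (if F = 0 then 1 else 0))"

definition L :: "((forest \<times> forest) \<times> (forest \<times> forest) \<Rightarrow>\<^sub>0 'k::field) \<Rightarrow> (forest \<times> forest \<Rightarrow>\<^sub>0 'k)" where
  "L = lin_ext (\<lambda>((x, y), (z, t)).
     B (bv x \<otimes> bv z) \<otimes> scale (counit (bv y * bv t)) 1 + (bv x * bv z) \<otimes> B (bv y \<otimes> bv t))"

lemma counit_simps [simp]:
  fixes x y :: "forest \<Rightarrow>\<^sub>0 'k::field"
  shows "counit (x + y) = counit x + counit y" "counit (scale c x) = c * counit x" "counit (0 :: forest \<Rightarrow>\<^sub>0 'k) = 0"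
proof -
  have *: "counit x = Poly_Mapping.lookup x 0" for x :: "forest \<Rightarrow>\<^sub>0 'k"
    by (simp add: counit_def sum.If_cases in_keys_iff if_distrib cong: if_cong)
  show "counit (x + y) = counit x + counit y" "counit (scale c x) = c * counit x" "counit (0 :: forest \<Rightarrow>\<^sub>0 'k) = 0"
    unfolding * by (simp_all add: lookup_add)
qed

lemma scale_mult [simp]:
  fixes x y :: "forest \<Rightarrow>\<^sub>0 'k::field"
  shows "scale c x * y = scale c (x * y)" "x * scale c y = scale c (x * y)"
proof -
  have bv: "scale c (bv b) = Poly_Mapping.single b c" for b :: forest and c :: 'k
    by (simp add: poly_mapping_eq_iff fun_eq_iff lookup_single when_def)
  have l: "scale c x = Poly_Mapping.single 0 c * x" for c and x :: "forest \<Rightarrow>\<^sub>0 'k"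
  proof (induction x arbitrary: c rule: bv_induct)
    case (scale d x)
    have "scale c (scale d x) = Poly_Mapping.single 0 (c * d) * x"
      using scale[of "c * d"] by simp
    also have "\<dots> = Poly_Mapping.single 0 c * (Poly_Mapping.single 0 d * x)"
      by (simp add: mult_single flip: mult.assoc)
    finally show ?case
      using scale[of d] by simp
  qed (simp_all add: bv mult_single pm.scale_right_distrib distrib_left)
  have r: "scale c x = x * Poly_Mapping.single 0 c" for c and x :: "forest \<Rightarrow>\<^sub>0 'k"
  proof (induction x arbitrary: c rule: bv_induct)
    case (scale d x)
    have "scale c (scale d x) = x * Poly_Mapping.single 0 (d * c)"
      using scale[of "c * d"] by (simp add: mult.commute)
    also have "\<dots> = (x * Poly_Mapping.single 0 d) * Poly_Mapping.single 0 c"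
      by (simp add: mult_single mult.assoc)
    finally show ?case
      using scale[of d] by simp
  qed (simp_all add: bv mult_single pm.scale_right_distrib distrib_right)
  show "scale c x * y = scale c (x * y)"
    by (simp add: l mult.assoc)
  show "x * scale c y = scale c (x * y)"
    by (simp add: r mult.assoc)
qed

text \<open>The defining formula of \<open>L\<close> holds for arbitrary, not only basis, vectors.\<close>

lemma L_tensor:
  "L ((x \<otimes> y) \<otimes> (z \<otimes> t)) =
     B (x \<otimes> z) \<otimes> scale (counit (y * t)) (1 :: forest \<Rightarrow>\<^sub>0 'k::field) + (x * z) \<otimes> B (y \<otimes> t)"
proof (induction x rule: bv_induct)
  case (bv x)
  show ?case
  proof (induction y rule: bv_induct)
    case (bv y)
    show ?case
    proof (induction z rule: bv_induct)
      case (bv z)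
      show ?case
        by (induction t rule: bv_induct)
          (simp_all add: L_def B_def algebra_simps pm.scale_left_distrib pm.scale_right_distrib)
    qed (simp_all add: L_def B_def algebra_simps pm.scale_right_distrib)
  qed (simp_all add: L_def B_def algebra_simps pm.scale_left_distrib pm.scale_right_distrib)
qed (simp_all add: L_def B_def algebra_simps pm.scale_right_distrib)

definition is_coproduct :: "((forest \<Rightarrow>\<^sub>0 'k::field) \<Rightarrow> (forest \<times> forest \<Rightarrow>\<^sub>0 'k)) \<Rightarrow> bool" where
  "is_coproduct \<Delta> \<longleftrightarrow>
     algebra_morphism (*) 1 (tensor_mult (*)) (1 \<otimes> 1) \<Delta> \<and>
     \<Delta> \<circ> B = L \<circ> tensor_map \<Delta> \<Delta>"

definition coproduct :: "(forest \<Rightarrow>\<^sub>0 'k::field) \<Rightarrow> (forest \<times> forest \<Rightarrow>\<^sub>0 'k)" where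
  "coproduct = (THE \<Delta>. is_coproduct \<Delta>)"

definition homogeneous :: "nat \<Rightarrow> (forest \<Rightarrow>\<^sub>0 'k::field) set" where
  "homogeneous n = pm.span {bv F |F. degree F = n}"

end

theory Submission
  imports Defs "HOL-Library.Product_Plus"
begin

text \<open>
  A nonempty forest is, in a unique way, the graft of two forests followed by a third forest.
  Consequently the algebra of forests is free in the following sense: for every linear operation
  from the tensor square of a unital algebra \<open>A\<close> to \<open>A\<close> there is exactly one algebra morphism to \<open>A\<close>
  that turns grafting into this operation (\<open>free_map_morphism\<close>, \<open>free_map_graft_forest\<close>,
  \<open>free_map_unique\<close>). Existence and uniqueness of the coproduct \<open>\<Delta>\<close> are the case of the operation \<open>L\<close>.

  The coalgebra axioms are identities between algebra morphisms, and uniqueness proves all of them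
  in the same way. The maps \<open>(\<epsilon> \<otimes> id) \<circ> \<Delta>\<close> and \<open>(id \<otimes> \<epsilon>) \<circ> \<Delta>\<close> turn grafting into grafting, as the
  identity does, because \<open>\<epsilon> \<otimes> id\<close> and \<open>id \<otimes> \<epsilon>\<close> turn \<open>L\<close> into \<open>B\<close> (\<open>form_left_L\<close>, \<open>form_right_L\<close>). The maps
  \<open>(\<Delta> \<otimes> id) \<circ> \<Delta>\<close> and \<open>(id \<otimes> \<Delta>) \<circ> \<Delta>\<close> both turn grafting into one explicit operation on the tensor cube
  (\<open>coproduct_left_L\<close>, \<open>coproduct_right_L\<close>). All tensor powers involved are monoid algebras of powers
  of the monoid of forests, so their products need no separate treatment.

  By induction over forests \<open>\<Delta>\<close> preserves the degree (\<open>degree_coproduct\<close>), and the empty forest is the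
  only one of degree 0. A connected graded bialgebra has an antipode: in the convolution algebra the
  identity is \<open>\<eta>\<epsilon> - (\<eta>\<epsilon> - id)\<close>, where \<open>\<eta>\<epsilon>\<close> is the unit, and the geometric series of
  \<open>\<eta>\<epsilon> - id\<close> is a finite sum on each element because \<open>\<eta>\<epsilon> - id\<close> vanishes in degree 0. Its sum is a
  two-sided inverse of the identity and preserves the degree (\<open>antipode_antipode_series\<close>,
  \<open>degree_antipode_series\<close>).
\<close>

section \<open>Linear maps between spaces with a basis\<close>

lemma linear_scale_iff:
  "Vector_Spaces.linear scale scale f \<longleftrightarrow>
     (\<forall>x y. f (x + y) = f x + f y) \<and> (\<forall>c x. f (scale c x) = scale c (f x))"
  for f :: "('a \<Rightarrow>\<^sub>0 'k::field) \<Rightarrow> ('b \<Rightarrow>\<^sub>0 'k)"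
  by (auto simp: Vector_Spaces.linear_def module_hom_axioms_def module_hom_def
      pm.vector_space_axioms pm.module_axioms)

lemma linear_simps:
  assumes "Vector_Spaces.linear scale scale f"
  shows "f (x + y) = f x + f y" "f (scale c x) = scale c (f x)" "f 0 = (0 :: 'b \<Rightarrow>\<^sub>0 'k::field)"
  using assms by (simp_all add: linear_scale_iff) (metis add_cancel_right_right)

lemma linear_eqI:
  assumes "Vector_Spaces.linear scale scale f" "Vector_Spaces.linear scale scale g"
    and "\<And>b. f (bv b) = g (bv b)"
  shows "f x = (g x :: 'b \<Rightarrow>\<^sub>0 'k::field)"
  by (induction x rule: bv_induct) (simp_all add: linear_simps[OF assms(1)] linear_simps[OF assms(2)] assms(3))

lemma linear_eq_lin_ext:
  assumes "Vector_Spaces.linear scale scale f"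
  shows "f = lin_ext (\<lambda>b. f (bv b))"
  by (rule ext, rule linear_eqI[OF assms linear_lin_ext]) simp

lemma lin_ext_cong:
  assumes "\<And>b. b \<in> Poly_Mapping.keys x \<Longrightarrow> f b = g b"
  shows "lin_ext f x = lin_ext g x"
  unfolding lin_ext_def by (rule sum.cong) (simp_all add: assms)

lemma keys_lin_ext: "Poly_Mapping.keys (lin_ext f x) \<subseteq> (\<Union>b\<in>Poly_Mapping.keys x. Poly_Mapping.keys (f b))"
proof
  fix c
  assume "c \<in> Poly_Mapping.keys (lin_ext f x)"
  then have "(\<Sum>b\<in>Poly_Mapping.keys x. Poly_Mapping.lookup x b * Poly_Mapping.lookup (f b) c) \<noteq> 0"
    by (simp add: in_keys_iff lin_ext_def lookup_sum)
  then obtain b where "b \<in> Poly_Mapping.keys x" "Poly_Mapping.lookup x b * Poly_Mapping.lookup (f b) c \<noteq> 0"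
    by (rule sum.not_neutral_contains_not_neutral)
  then show "c \<in> (\<Union>b\<in>Poly_Mapping.keys x. Poly_Mapping.keys (f b))"
    by (auto simp: in_keys_iff)
qed

text \<open>
  Homogeneity is a condition on supports. This turns every statement about a subspace spanned by
  basis vectors, and hence about the grading, into one about keys.
\<close>

lemma span_bv: "pm.span {bv b |b. P b} = {x :: 'b \<Rightarrow>\<^sub>0 'k::field. \<forall>b\<in>Poly_Mapping.keys x. P b}"
proof (intro equalityI subsetI CollectI ballI)
  fix x :: "'b \<Rightarrow>\<^sub>0 'k" and b
  assume "x \<in> pm.span {bv b |b. P b}" "b \<in> Poly_Mapping.keys x"
  then show "P b"
  proof (induction x arbitrary: b rule: pm.span_induct_alt)
    case (step c x y)
    then show ?case
      by (auto simp: in_keys_iff lookup_add lookup_single when_def split: if_splits)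
  qed simp
next
  fix x :: "'b \<Rightarrow>\<^sub>0 'k"
  assume "x \<in> {x. \<forall>b\<in>Poly_Mapping.keys x. P b}"
  moreover have "x = lin_ext bv x"
    by (rule linear_eqI[OF _ linear_lin_ext]) (simp_all add: linear_scale_iff)
  moreover have "lin_ext bv x \<in> pm.span {bv b |b. P b}" if "\<forall>b\<in>Poly_Mapping.keys x. P b"
    unfolding lin_ext_def using that by (auto intro!: pm.span_sum pm.span_scale intro: pm.span_base)
  ultimately show "x \<in> pm.span {bv b |b. P b}"
    by simp
qed

lemma keys_tensor: "Poly_Mapping.keys (x \<otimes> y) \<subseteq> Poly_Mapping.keys x \<times> Poly_Mapping.keys y"
proof -
  have sub: "Poly_Mapping.keys (lin_ext (\<lambda>b. bv (a, b)) y) \<subseteq> {a} \<times> Poly_Mapping.keys y" for a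
    by (rule order_trans[OF keys_lin_ext]) auto
  have "(\<Union>a\<in>Poly_Mapping.keys x. Poly_Mapping.keys (lin_ext (\<lambda>b. bv (a, b)) y))
      \<subseteq> Poly_Mapping.keys x \<times> Poly_Mapping.keys y"
    by (intro UN_least order_trans[OF sub]) auto
  then show ?thesis
    unfolding tensor_def by (rule order_trans[OF keys_lin_ext])
qed

section \<open>Monoid algebras\<close>

lemma scale_eq_mult_left: "scale c x = Poly_Mapping.single 0 c * x"
  for x :: "'a::monoid_add \<Rightarrow>\<^sub>0 'k::field"
proof (induction x arbitrary: c rule: bv_induct)
  case (scale d x)
  have "scale c (scale d x) = Poly_Mapping.single 0 (c * d) * x"
    using scale[of "c * d"] by simp
  then show ?case
    using scale[of d] by (simp add: mult_single flip: mult.assoc)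
next
  case (bv b)
  show ?case
    by (simp add: mult_single poly_mapping_eq_iff fun_eq_iff lookup_single when_def)
qed (simp_all add: pm.scale_right_distrib distrib_left)

lemma scale_eq_mult_right: "scale c x = x * Poly_Mapping.single 0 c"
  for x :: "'a::monoid_add \<Rightarrow>\<^sub>0 'k::field"
proof (induction x arbitrary: c rule: bv_induct)
  case (scale d x)
  have "scale c (scale d x) = x * Poly_Mapping.single 0 (d * c)"
    using scale[of "c * d"] by (simp add: mult.commute)
  then show ?case
    using scale[of d] by (simp add: mult_single mult.assoc)
next
  case (bv b)
  show ?case
    by (simp add: mult_single poly_mapping_eq_iff fun_eq_iff lookup_single when_def)
qed (simp_all add: pm.scale_right_distrib distrib_right)

lemma monoid_algebra_scale_mult:
  fixes x y :: "'a::monoid_add \<Rightarrow>\<^sub>0 'k::field"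
  shows "scale c x * y = scale c (x * y)" "x * scale c y = scale c (x * y)"
  by (simp add: scale_eq_mult_left mult.assoc) (simp add: scale_eq_mult_right mult.assoc)

lemma unital_algebra_monoid_algebra:
  "unital_algebra ((*) :: ('a::monoid_add \<Rightarrow>\<^sub>0 'k::field) \<Rightarrow> _) 1"
  by unfold_locales
    (simp_all add: linear_scale_iff monoid_algebra_scale_mult distrib_left distrib_right mult.assoc)

text \<open>
  The product of two monoids is a monoid, and a tensor product of monoid algebras is the monoid
  algebra of the product. So the tensor square and the tensor cube of the algebra of forests need no
  structure of their own: their product is again \<open>(*)\<close> and their unit is \<open>1\<close>.
\<close>

lemma tensor_mult_monoid_algebra:
  "tensor_mult (*) = ((*) :: ('a::monoid_add \<times> 'a \<Rightarrow>\<^sub>0 'k::field) \<Rightarrow> _)"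
proof (intro ext)
  fix u v :: "'a \<times> 'a \<Rightarrow>\<^sub>0 'k"
  show "tensor_mult (*) u v = u * v"
  proof (induction u rule: bv_induct)
    case (bv p)
    show ?case
    proof (induction v rule: bv_induct)
      case (bv q)
      show ?case
        by (cases p; cases q) (simp add: tensor_mult_def mult_single)
    qed (simp_all add: tensor_mult_def monoid_algebra_scale_mult distrib_left split: prod.splits)
  qed (simp_all add: tensor_mult_def monoid_algebra_scale_mult distrib_right)
qed

lemma one_tensor_one: "(1 \<otimes> 1 :: 'a::monoid_add \<times> 'b::monoid_add \<Rightarrow>\<^sub>0 'k::field) = 1"
  by (simp add: zero_prod_def flip: single_one)

lemma tensor_times_tensor: "(x \<otimes> y) * (z \<otimes> t) = (x * z) \<otimes> (y * t)"
  for x z :: "'a::monoid_add \<Rightarrow>\<^sub>0 'k::field" and y t :: "'b::monoid_add \<Rightarrow>\<^sub>0 'k"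
proof (induction x rule: bv_induct)
  case (bv x)
  show ?case
  proof (induction y rule: bv_induct)
    case (bv y)
    show ?case
    proof (induction z rule: bv_induct)
      case (bv z)
      show ?case
        by (induction t rule: bv_induct)
          (simp_all add: mult_single distrib_left monoid_algebra_scale_mult)
    qed (simp_all add: distrib_left monoid_algebra_scale_mult)
  qed (simp_all add: distrib_right monoid_algebra_scale_mult)
qed (simp_all add: distrib_right monoid_algebra_scale_mult)

lemma algebra_morphismI:
  fixes f :: "('a::monoid_add \<Rightarrow>\<^sub>0 'k::field) \<Rightarrow> ('b::monoid_add \<Rightarrow>\<^sub>0 'k)"
  assumes f: "Vector_Spaces.linear scale scale f" and one: "f (bv 0) = 1"
    and mult: "\<And>a b. f (bv (a + b)) = f (bv a) * f (bv b)"
  shows "algebra_morphism (*) 1 (*) 1 f"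
proof -
  have "f (x * y) = f x * f y" for x y
  proof (induction x rule: bv_induct)
    case (bv x)
    show ?case
      by (induction y rule: bv_induct)
        (simp_all add: linear_simps[OF f] mult mult_single distrib_left monoid_algebra_scale_mult)
  qed (simp_all add: linear_simps[OF f] distrib_right monoid_algebra_scale_mult)
  then show ?thesis
    using f one by (simp add: algebra_morphism_def)
qed

lemma algebra_morphism_comp:
  assumes "algebra_morphism m1 e1 m2 e2 f" "algebra_morphism m2 e2 m3 e3 g"
  shows "algebra_morphism m1 e1 m3 e3 (g \<circ> f)"
  using assms by (auto simp: algebra_morphism_def linear_scale_iff)

lemma algebra_morphism_tensor_map:
  fixes f :: "('a::monoid_add \<Rightarrow>\<^sub>0 'k::field) \<Rightarrow> ('c::monoid_add \<Rightarrow>\<^sub>0 'k)"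
    and g :: "('b::monoid_add \<Rightarrow>\<^sub>0 'k) \<Rightarrow> ('d::monoid_add \<Rightarrow>\<^sub>0 'k)"
  assumes f: "algebra_morphism (*) 1 (*) 1 f" and g: "algebra_morphism (*) 1 (*) 1 g"
  shows "algebra_morphism (*) 1 (*) 1 (tensor_map f g)"
proof (rule algebra_morphismI)
  show "Vector_Spaces.linear scale scale (tensor_map f g)"
    unfolding tensor_map_def by (rule linear_lin_ext)
  show "tensor_map f g (bv 0) = 1"
    using f g by (simp add: tensor_map_def zero_prod_def algebra_morphism_def one_tensor_one del: single_one)
      (simp add: one_tensor_one)
  have mult: "f (bv (a + b)) = f (bv a) * f (bv b)" "g (bv (c + d)) = g (bv c) * g (bv d)" for a b c d
    using f g by (simp_all add: algebra_morphism_def flip: mult_single[where ?a = "1::'k" and ?b = 1, simplified])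
  show "tensor_map f g (bv (p + q)) = tensor_map f g (bv p) * tensor_map f g (bv q)" for p q
    by (cases p; cases q) (simp add: tensor_map_def mult tensor_times_tensor)
qed

lemma algebra_morphism_tensor_assoc:
  "algebra_morphism (*) 1 (*) 1
    (tensor_assoc :: (('a::monoid_add \<times> 'b::monoid_add) \<times> 'c::monoid_add \<Rightarrow>\<^sub>0 'k::field) \<Rightarrow> _)"
proof (rule algebra_morphismI)
  show "tensor_assoc (bv (p + q)) = tensor_assoc (bv p) * (tensor_assoc (bv q) :: 'a \<times> 'b \<times> 'c \<Rightarrow>\<^sub>0 'k)" for p q
    by (cases p; cases q) (auto simp: tensor_assoc_def mult_single)
  show "tensor_assoc (bv 0) = (1 :: 'a \<times> 'b \<times> 'c \<Rightarrow>\<^sub>0 'k)"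
    unfolding tensor_assoc_def lin_ext_bv by (simp add: zero_prod_def flip: single_one)
qed (simp add: tensor_assoc_def linear_lin_ext)

section \<open>Forests as a free structure\<close>

text \<open>
  Sorting the edges at the root by their decoration recovers both forests, which gives the unique
  decomposition of a nonempty forest as \<open>graft_forest F G + H\<close>.
\<close>

lemma graft_trees_inject: "graft_trees Fs Gs = graft_trees Fs' Gs' \<longleftrightarrow> Fs = Fs' \<and> Gs = Gs'"
proof
  have "Fs = map snd (filter (\<lambda>e. fst e = Lft) es) \<and> Gs = map snd (filter (\<lambda>e. fst e = Rgt) es)"
    if "graft_trees Fs Gs = Node es" for Fs Gs es
    using that by (auto simp: graft_trees_def comp_def)
  then show "Fs = Fs' \<and> Gs = Gs'" if "graft_trees Fs Gs = graft_trees Fs' Gs'"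
    using that by (metis dtree.exhaust)
qed simp

lemma graft_forest_plus_inject [simp]:
  "graft_forest F G + H = graft_forest F' G' + H' \<longleftrightarrow> F = F' \<and> G = G' \<and> H = H'"
  by transfer (simp add: graft_trees_inject)

lemma graft_forest_plus_neq_zero [simp]:
  "graft_forest F G + H \<noteq> 0" "0 \<noteq> graft_forest F G + H"
  by (transfer; simp)+

lemma forest_cases [case_names zero graft]:
  obtains "F = 0" | F1 F2 H where "F = graft_forest F1 F2 + H"
proof (transfer fixing: thesis)
  fix F
  assume F: "F \<in> lists TT" and zero: "F = [] \<Longrightarrow> thesis"
    and graft: "\<And>F1 F2 H. F1 \<in> lists TT \<Longrightarrow> F2 \<in> lists TT \<Longrightarrow> H \<in> lists TT
      \<Longrightarrow> F = [graft_trees F1 F2] @ H \<Longrightarrow> thesis"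
  show thesis
  proof (cases F)
    case (Cons t H)
    with F have "t \<in> TT" "H \<in> lists TT"
      by simp_all
    then show thesis
      using Cons graft by (cases t rule: TT.cases) auto
  qed (rule zero)
qed

lemma degree_zero [simp]: "degree 0 = 0"
  by (simp add: degree_def zero_forest.rep_eq)

lemma degree_plus [simp]: "degree (F + G) = degree F + degree G"
  by (simp add: degree_def plus_forest.rep_eq)

lemma degree_graft_forest [simp]: "degree (graft_forest F G) = Suc (degree F + degree G)"
  by (simp add: degree_def graft_forest.rep_eq graft_trees_def comp_def)

lemma degree_eq_zero_iff [simp]: "degree F = 0 \<longleftrightarrow> F = 0"
  by (cases F rule: forest_cases) simp_all

lemma forest_induct [case_names zero graft]:
  assumes "P 0" and "\<And>F G H. P F \<Longrightarrow> P G \<Longrightarrow> P H \<Longrightarrow> P (graft_forest F G + H)"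
  shows "P F"
proof (induction "degree F" arbitrary: F rule: less_induct)
  case less
  show ?case
    by (cases F rule: forest_cases) (use less assms in auto)
qed

text \<open>
  The unique decomposition of forests makes a recursion on the degree well defined. It computes the
  value at a forest of the algebra morphism that turns grafting into a prescribed operation \<open>M\<close> on the
  target algebra.
\<close>

function free_map :: "(('b \<Rightarrow>\<^sub>0 'k::field) \<Rightarrow> ('b \<Rightarrow>\<^sub>0 'k) \<Rightarrow> ('b \<Rightarrow>\<^sub>0 'k)) \<Rightarrow> ('b \<Rightarrow>\<^sub>0 'k)
    \<Rightarrow> (('b \<times> 'b \<Rightarrow>\<^sub>0 'k) \<Rightarrow> ('b \<Rightarrow>\<^sub>0 'k)) \<Rightarrow> forest \<Rightarrow> ('b \<Rightarrow>\<^sub>0 'k)" where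
  "free_map mult one M 0 = one"
| "free_map mult one M (graft_forest F G + H) =
     mult (M (free_map mult one M F \<otimes> free_map mult one M G)) (free_map mult one M H)"
  subgoal for P x
    by (cases x; cases "snd (snd (snd x))" rule: forest_cases) auto
  by (auto)
termination
  by (relation "measure (\<lambda>(_, _, _, F). degree F)") auto

text \<open>
  The uniqueness half of the universal property. Besides the uniqueness of the coproduct it gives
  the counit laws and coassociativity: each compares two morphisms that turn grafting into the same
  operation.
\<close>

lemma free_map_unique:
  assumes f: "algebra_morphism (*) 1 mult one f"
    and f_graft: "\<And>F G. f (bv (graft_forest F G)) = M (f (bv F) \<otimes> f (bv G))"
    and g: "algebra_morphism (*) 1 mult one g"
    and g_graft: "\<And>F G. g (bv (graft_forest F G)) = M (g (bv F) \<otimes> g (bv G))"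
  shows "f = g"
proof
  have "f (bv F) = g (bv F)" for F
  proof (induction F rule: forest_induct)
    case (graft F G H)
    have bv: "bv (graft_forest F G + H) = bv (graft_forest F G) * bv H"
      by (simp add: mult_single)
    show ?case
      unfolding bv using f g by (simp add: algebra_morphism_def f_graft g_graft graft)
  qed (use f g in \<open>simp add: algebra_morphism_def\<close>)
  then show "f x = g x" for x
    using linear_eqI[of f g x] f g by (simp add: algebra_morphism_def)
qed

context unital_algebra
begin

lemma free_map_morphism: "algebra_morphism (*) 1 mult one (lin_ext (free_map mult one M))"
proof -
  let ?f = "lin_ext (free_map mult one M)"
  have plus: "free_map mult one M (F + G) = mult (free_map mult one M F) (free_map mult one M G)" for F G
    by (induction F rule: forest_induct) (simp_all add: one_left mult_assoc add.assoc)
  note mult_simps = linear_simps[OF mult_linear_left] linear_simps[OF mult_linear_right]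
  have "?f (x * y) = mult (?f x) (?f y)" for x y
  proof (induction x rule: bv_induct)
    case (bv x)
    show ?case
      by (induction y rule: bv_induct) (simp_all add: mult_simps mult_single plus distrib_left)
  qed (simp_all add: mult_simps distrib_right)
  then show ?thesis
    by (simp add: algebra_morphism_def linear_lin_ext flip: single_one)
qed

lemma free_map_graft_forest:
  "free_map mult one M (graft_forest F G) = M (free_map mult one M F \<otimes> free_map mult one M G)"
  using free_map.simps(2)[of mult one M F G 0] by (simp add: one_right)

end

section \<open>The coproduct\<close>

lemma bv_tensor_one [simp]: "bv a \<otimes> (1 :: 'b::monoid_add \<Rightarrow>\<^sub>0 'k::field) = bv (a, 0)"
  by (simp flip: single_one)

lemma plus_eq_zero_forest_iff [simp]: "F + G = 0 \<longleftrightarrow> F = 0 \<and> G = 0" for F G :: forest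
  by (metis add_is_0 degree_eq_zero_iff degree_plus)

lemma graft_forest_neq_zero [simp]: "graft_forest F G \<noteq> 0"
  by (metis degree_eq_zero_iff degree_graft_forest nat.distinct(1))

lemma counit_bv [simp]: "counit (bv F) = (if F = 0 then 1 else 0)"
  by (simp add: counit_def)

lemma counit_mult: "counit (x * y) = counit x * counit y"
proof (induction x rule: bv_induct)
  case (bv x)
  show ?case
    by (induction y rule: bv_induct) (simp_all add: distrib_left mult_single)
qed (simp_all add: distrib_right)

lemma counit_one [simp]: "counit 1 = 1"
  by (simp flip: single_one)

text \<open>
  The first summand is nonzero only if \<open>b\<close> and \<open>d\<close> are empty. So no vertex is lost, and \<open>L\<close> raises the
  total degree by the one vertex that grafting adds.
\<close>

lemma L_basis:
  "L (bv ((a, b), (c, d))) = scale (counit (bv (b + d))) (bv (graft_forest a c, 0)) + bv (a + c, graft_forest b d)"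
  by (simp add: L_def B_def mult_single)

lemma L_simps [simp]: "L (x + y) = L x + L y" "L (scale c x) = scale c (L x)" "L 0 = 0"
  by (simp_all add: L_def)

lemma B_simps [simp]: "B (x + y) = B x + B y" "B (scale c x) = scale c (B x)" "B 0 = 0"
  "B (bv (F, G)) = bv (graft_forest F G)"
  by (simp_all add: B_def)

text \<open>
  By linearity the identity \<open>\<Delta> \<circ> B = L \<circ> (\<Delta> \<otimes> \<Delta>)\<close> needs to be known on pairs of forests only, where it is
  the hypothesis of the universal property.
\<close>

lemma is_coproduct_iff:
  "is_coproduct \<Delta> \<longleftrightarrow> algebra_morphism (*) 1 (*) 1 \<Delta> \<and>
    (\<forall>F G. \<Delta> (bv (graft_forest F G)) = L (\<Delta> (bv F) \<otimes> \<Delta> (bv G)))" (is "_ \<longleftrightarrow> ?morph \<and> ?graft")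
proof -
  have "?graft" if "\<Delta> \<circ> B = L \<circ> tensor_map \<Delta> \<Delta>"
    using fun_cong[OF that, of "bv (_, _)"] by (simp add: tensor_map_def)
  moreover have "\<Delta> \<circ> B = L \<circ> tensor_map \<Delta> \<Delta>" if ?morph ?graft
  proof (rule ext)
    from \<open>?morph\<close> have \<Delta>: "Vector_Spaces.linear scale scale \<Delta>"
      by (simp add: algebra_morphism_def)
    show "(\<Delta> \<circ> B) x = (L \<circ> tensor_map \<Delta> \<Delta>) x" for x
      by (rule linear_eqI)
        (use \<open>?graft\<close> in \<open>auto simp: linear_scale_iff linear_simps[OF \<Delta>] tensor_map_def\<close>)
  qed
  ultimately show ?thesis
    unfolding is_coproduct_def tensor_mult_monoid_algebra one_tensor_one by blast
qed

lemma ex1_coproduct: "\<exists>!\<Delta> :: (forest \<Rightarrow>\<^sub>0 'k::field) \<Rightarrow> _. is_coproduct \<Delta>"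
proof
  interpret unital_algebra "(*) :: (forest \<times> forest \<Rightarrow>\<^sub>0 'k) \<Rightarrow> _" 1
    by (rule unital_algebra_monoid_algebra)
  show "is_coproduct (lin_ext (free_map (*) 1 (L :: _ \<Rightarrow> (forest \<times> forest \<Rightarrow>\<^sub>0 'k))))"
    unfolding is_coproduct_iff by (simp add: free_map_morphism free_map_graft_forest)
  show "\<Delta> = lin_ext (free_map (*) 1 L)" if "is_coproduct \<Delta>" for \<Delta> :: "(forest \<Rightarrow>\<^sub>0 'k) \<Rightarrow> _"
    using that unfolding is_coproduct_iff
    by (intro free_map_unique[where M = L]) (auto simp: free_map_morphism free_map_graft_forest)
qed

lemma coproduct_morphism: "algebra_morphism (*) 1 (*) 1 coproduct"
  and coproduct_graft_forest: "coproduct (bv (graft_forest F G)) = L (coproduct (bv F) \<otimes> coproduct (bv G))"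
  using theI'[OF ex1_coproduct] unfolding is_coproduct_iff coproduct_def by auto

lemmas linear_coproduct = conjunct1[OF coproduct_morphism[unfolded algebra_morphism_def]]
  and coproduct_one [simp] = conjunct1[OF conjunct2[OF coproduct_morphism[unfolded algebra_morphism_def]]]
  and coproduct_mult = conjunct2[OF conjunct2[OF coproduct_morphism[unfolded algebra_morphism_def]], rule_format]

lemmas coproduct_simps [simp] = linear_simps[OF linear_coproduct]

lemma coproduct_plus: "coproduct (bv (F + G)) = coproduct (bv F) * coproduct (bv G)"
  by (simp add: mult_single flip: coproduct_mult)

lemma form_simps [simp]:
  "form_left \<epsilon> (u + v) = form_left \<epsilon> u + form_left \<epsilon> v" "form_left \<epsilon> (scale c u) = scale c (form_left \<epsilon> u)"
  "form_left \<epsilon> 0 = 0" "form_left \<epsilon> (bv (a, b)) = scale (\<epsilon> (bv a)) (bv b)"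
  "form_right \<epsilon> (u + v) = form_right \<epsilon> u + form_right \<epsilon> v"
  "form_right \<epsilon> (scale c u) = scale c (form_right \<epsilon> u)"
  "form_right \<epsilon> 0 = 0" "form_right \<epsilon> (bv (a, b)) = scale (\<epsilon> (bv b)) (bv a)"
  by (simp_all add: form_left_def form_right_def)

text \<open>
  \<open>\<epsilon> \<otimes> id\<close> kills the first summand of \<open>L\<close>, since a grafted tree is not empty, and sends the second one
  to the graft of what remains. So \<open>(\<epsilon> \<otimes> id) \<circ> \<Delta>\<close> turns grafting into grafting, as the identity does.
\<close>

lemma form_left_L: "form_left counit (L (u \<otimes> v)) = B (form_left counit u \<otimes> form_left counit v)"
proof (induction u rule: bv_induct)
  case (bv p)
  show ?case
    by (induction v rule: bv_induct, simp_all) (cases p; auto simp: L_basis split: prod.splits)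
qed simp_all

text \<open>
  Here the second summand dies, and multiplicativity of \<open>\<epsilon>\<close> splits the scalar of the first.
\<close>

lemma form_right_L: "form_right counit (L (u \<otimes> v)) = B (form_right counit u \<otimes> form_right counit v)"
proof (induction u rule: bv_induct)
  case (bv p)
  show ?case
    by (induction v rule: bv_induct, simp_all) (cases p; auto simp: L_basis split: prod.splits)
qed simp_all

lemma form_morphism:
  "algebra_morphism (*) 1 (*) 1 (form_left counit :: (forest \<times> forest \<Rightarrow>\<^sub>0 'k::field) \<Rightarrow> _)"
  "algebra_morphism (*) 1 (*) 1 (form_right counit :: (forest \<times> forest \<Rightarrow>\<^sub>0 'k) \<Rightarrow> _)"
  by (rule algebra_morphismI; auto simp: linear_scale_iff zero_prod_def mult_single split: prod.splits)+

lemma algebra_morphism_id: "algebra_morphism m e m e id"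
  by (simp add: algebra_morphism_def linear_scale_iff)

lemma coproduct_counit_left: "form_left counit (coproduct x) = x"
proof -
  have "form_left counit \<circ> coproduct = id"
    by (rule free_map_unique[where M = B and mult = "(*)" and one = 1])
      (simp_all add: algebra_morphism_comp[OF coproduct_morphism form_morphism(1)] algebra_morphism_id
        coproduct_graft_forest form_left_L)
  then show ?thesis by (metis comp_apply id_apply)
qed

lemma coproduct_counit_right: "form_right counit (coproduct x) = x"
proof -
  have "form_right counit \<circ> coproduct = id"
    by (rule free_map_unique[where M = B and mult = "(*)" and one = 1])
      (simp_all add: algebra_morphism_comp[OF coproduct_morphism form_morphism(2)] algebra_morphism_id
        coproduct_graft_forest form_right_L)
  then show ?thesis by (metis comp_apply id_apply)
qed

text \<open>
  The operation on the tensor cube into which both iterated coproducts turn grafting: the new root goes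
  to one of the three tensor factors, and the counit requires the factors to the right of it to be
  empty.
\<close>

definition triple_graft ::
    "((forest \<times> forest \<times> forest) \<times> (forest \<times> forest \<times> forest) \<Rightarrow>\<^sub>0 'k::field)
      \<Rightarrow> (forest \<times> forest \<times> forest \<Rightarrow>\<^sub>0 'k)" where
  "triple_graft = lin_ext (\<lambda>((a, b, c), (a', b', c')).
     scale (counit (bv (b + c + b' + c'))) (bv (graft_forest a a', 0, 0))
     + scale (counit (bv (c + c'))) (bv (a + a', graft_forest b b', 0))
     + bv (a + a', b + b', graft_forest c c'))"

lemma triple_graft_simps [simp]:
  "triple_graft (x + y) = triple_graft x + triple_graft y"
  "triple_graft (scale c x) = scale c (triple_graft x)" "triple_graft 0 = 0"
  by (simp_all add: triple_graft_def)

lemma tensor_assoc_simps [simp]: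
  "tensor_assoc (x + y) = tensor_assoc x + tensor_assoc y"
  "tensor_assoc (scale c x) = scale c (tensor_assoc x)" "tensor_assoc 0 = 0"
  "tensor_assoc (bv ((a, b), d)) = bv (a, b, d)"
  by (simp_all add: tensor_assoc_def)

lemma tensor_map_simps [simp]:
  "tensor_map f g (x + y) = tensor_map f g x + tensor_map f g y"
  "tensor_map f g (scale c x) = scale c (tensor_map f g x)" "tensor_map f g 0 = 0"
  "tensor_map f g (bv (a, b)) = f (bv a) \<otimes> g (bv b)"
  by (simp_all add: tensor_map_def)

text \<open>
  The iterated coproduct \<open>(\<Delta> \<otimes> id) \<circ> \<Delta>\<close> of a graft, with the values of \<open>\<Delta>\<close> on the two left factors
  replaced by arbitrary elements \<open>p\<close> and \<open>q\<close>; both sides are bilinear in these, so basis vectors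
  suffice.
\<close>

lemma triple_graft_left_basis:
  "scale (counit (bv (b + d))) (tensor_assoc (L (p \<otimes> q) \<otimes> 1)) + tensor_assoc ((p * q) \<otimes> bv (graft_forest b d))
    = triple_graft (tensor_assoc (p \<otimes> bv b) \<otimes> tensor_assoc (q \<otimes> bv d))"
proof (induction p rule: bv_induct)
  case (bv p)
  show ?case
  proof (induction q rule: bv_induct)
    case (bv q)
    show ?case
      by (cases p; cases q) (auto simp: L_basis mult_single triple_graft_def pm.scale_right_distrib)
  next
    case (scale k q)
    show ?case
      using arg_cong[OF scale, of "scale k"]
      by (simp add: monoid_algebra_scale_mult pm.scale_right_distrib mult.commute del: counit_bv)
  qed (simp_all add: distrib_left pm.scale_right_distrib algebra_simps del: counit_bv)
next
  case (scale k p)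
  show ?case
    using arg_cong[OF scale, of "scale k"]
    by (simp add: monoid_algebra_scale_mult pm.scale_right_distrib mult.commute del: counit_bv)
qed (simp_all add: distrib_right pm.scale_right_distrib algebra_simps del: counit_bv)

text \<open>
  The same for \<open>(id \<otimes> \<Delta>) \<circ> \<Delta>\<close>. The scalar is written with \<open>(\<epsilon> \<otimes> \<epsilon>)(p)\<close> so that the formula is bilinear in
  \<open>p\<close> and \<open>q\<close>; for \<open>p = \<Delta> b\<close> the left counit law makes it \<open>\<epsilon>(b)\<close>.
\<close>

lemma triple_graft_right_basis:
  "scale (counit (form_left counit p) * counit (form_left counit q)) (bv (graft_forest a c, 0, 0))
    + bv (a + c) \<otimes> L (p \<otimes> q) = triple_graft ((bv a \<otimes> p) \<otimes> (bv c \<otimes> q))"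
proof (induction p rule: bv_induct)
  case (bv p)
  show ?case
  proof (induction q rule: bv_induct)
    case (bv q)
    show ?case
      by (cases p; cases q) (auto simp: L_basis triple_graft_def)
  next
    case (scale k q)
    show ?case
      using arg_cong[OF scale, of "scale k"] by (simp add: pm.scale_right_distrib mult_ac)
  qed (simp_all add: pm.scale_left_distrib algebra_simps)
next
  case (scale k p)
  show ?case
    using arg_cong[OF scale, of "scale k"] by (simp add: pm.scale_right_distrib mult_ac)
qed (simp_all add: pm.scale_left_distrib algebra_simps)

lemma coproduct_left_L:
  "tensor_assoc (tensor_map coproduct id (L (u \<otimes> v)))
    = triple_graft (tensor_assoc (tensor_map coproduct id u) \<otimes> tensor_assoc (tensor_map coproduct id v))"
proof (induction u rule: bv_induct)
  case (bv p)
  show ?case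
  proof (induction v rule: bv_induct)
    case (bv q)
    obtain a b c d where [simp]: "p = (a, b)" "q = (c, d)"
      by (metis surj_pair)
    show ?case
      using triple_graft_left_basis[of b d "coproduct (bv a)" "coproduct (bv c)"]
      by (simp add: L_basis coproduct_graft_forest coproduct_plus del: counit_bv)
  qed simp_all
qed simp_all

lemma coproduct_right_L:
  fixes u v :: "forest \<times> forest \<Rightarrow>\<^sub>0 'k::field"
  shows "tensor_map id coproduct (L (u \<otimes> v))
    = triple_graft (tensor_map id coproduct u \<otimes> tensor_map id coproduct v)"
proof (induction u rule: bv_induct)
  case (bv p)
  show ?case
  proof (induction v rule: bv_induct)
    case (bv q)
    obtain a b c d where [simp]: "p = (a, b)" "q = (c, d)"
      by (metis surj_pair)
    have "counit (bv (b + d) :: forest \<Rightarrow>\<^sub>0 'k) = counit (bv b :: forest \<Rightarrow>\<^sub>0 'k) * counit (bv d :: forest \<Rightarrow>\<^sub>0 'k)"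
      by simp
    then show ?case
      using triple_graft_right_basis[of "coproduct (bv b)" "coproduct (bv d)" a c]
      by (simp add: L_basis coproduct_graft_forest coproduct_counit_left zero_prod_def del: counit_bv)
  qed simp_all
qed simp_all

text \<open>
  Both iterated coproducts are algebra morphisms to the tensor cube that turn grafting into
  \<open>triple_graft\<close>, so the universal property identifies them.
\<close>

lemma coproduct_coassoc: "tensor_assoc (tensor_map coproduct id (coproduct x)) = tensor_map id coproduct (coproduct x)"
proof -
  have "tensor_assoc \<circ> (tensor_map coproduct id \<circ> coproduct) = tensor_map id coproduct \<circ> coproduct"
  proof (rule free_map_unique[where M = triple_graft and mult = "(*)" and one = 1])
    note morphs = coproduct_morphism algebra_morphism_id algebra_morphism_tensor_map
    show "algebra_morphism (*) 1 (*) 1 (tensor_assoc \<circ> (tensor_map coproduct id \<circ> coproduct))"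
      by (rule algebra_morphism_comp[OF algebra_morphism_comp[OF _ _] algebra_morphism_tensor_assoc])
        (rule morphs)+
    show "algebra_morphism (*) 1 (*) 1 (tensor_map id coproduct \<circ> coproduct)"
      by (rule algebra_morphism_comp) (rule morphs)+
  qed (simp_all add: coproduct_graft_forest coproduct_left_L coproduct_right_L)
  then show ?thesis by (metis comp_apply)
qed

lemma degree_L:
  fixes u v :: "forest \<times> forest \<Rightarrow>\<^sub>0 'k::field"
  assumes "(a, b) \<in> Poly_Mapping.keys (L (u \<otimes> v))"
    and "\<And>a b. (a, b) \<in> Poly_Mapping.keys u \<Longrightarrow> degree a + degree b = m"
    and "\<And>a b. (a, b) \<in> Poly_Mapping.keys v \<Longrightarrow> degree a + degree b = n"
  shows "degree a + degree b = Suc (m + n)"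
proof -
  have L_lin_ext: "lin_ext (\<lambda>p. L (bv p)) = (L :: _ \<Rightarrow> _ \<Rightarrow>\<^sub>0 'k)"
    by (rule linear_eq_lin_ext[symmetric]) (simp add: linear_scale_iff)
  have "Poly_Mapping.keys (L (u \<otimes> v)) \<subseteq> (\<Union>p\<in>Poly_Mapping.keys (u \<otimes> v). Poly_Mapping.keys (L (bv p) :: _ \<Rightarrow>\<^sub>0 'k))"
    using keys_lin_ext[of "\<lambda>p. L (bv p)" "u \<otimes> v"] by (simp only: L_lin_ext)
  with assms(1) obtain p where p: "p \<in> Poly_Mapping.keys (u \<otimes> v)" "(a, b) \<in> Poly_Mapping.keys (L (bv p) :: _ \<Rightarrow>\<^sub>0 'k)"
    by blast
  obtain c d e f where [simp]: "p = ((c, d), (e, f))"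
    by (metis surj_pair)
  have "(c, d) \<in> Poly_Mapping.keys u" "(e, f) \<in> Poly_Mapping.keys v"
    using p(1) keys_tensor[of u v] by auto
  then have "degree c + degree d = m" "degree e + degree f = n"
    using assms by auto
  moreover have "(a, b) = (graft_forest c e, 0) \<and> d = 0 \<and> f = 0 \<or> (a, b) = (c + e, graft_forest d f)"
    using p(2) by (auto simp: L_basis in_keys_iff lookup_add lookup_single when_def split: if_splits)
  ultimately show ?thesis
    by auto
qed

lemma degree_coproduct:
  "(a, b) \<in> Poly_Mapping.keys (coproduct (bv F) :: _ \<Rightarrow>\<^sub>0 'k::field) \<Longrightarrow> degree a + degree b = degree F"
proof (induction F arbitrary: a b rule: forest_induct)
  case zero
  have "(coproduct (bv 0) :: _ \<Rightarrow>\<^sub>0 'k) = bv (0, 0)"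
    by (metis coproduct_one single_one zero_prod_def)
  with zero show ?case
    by (auto simp: zero_prod_def)
next
  case (graft F G H)
  then have "(a, b) \<in> Poly_Mapping.keys (L (coproduct (bv F) \<otimes> coproduct (bv G)) * coproduct (bv H) :: _ \<Rightarrow>\<^sub>0 'k)"
    by (simp add: coproduct_plus coproduct_graft_forest)
  then obtain p q where pq: "p \<in> Poly_Mapping.keys (L (coproduct (bv F) \<otimes> coproduct (bv G)) :: _ \<Rightarrow>\<^sub>0 'k)"
      "q \<in> Poly_Mapping.keys (coproduct (bv H) :: _ \<Rightarrow>\<^sub>0 'k)" "(a, b) = p + q"
    using keys_mult by fastforce
  obtain p1 p2 q1 q2 where [simp]: "p = (p1, p2)" "q = (q1, q2)"
    by (metis surj_pair)
  have "degree p1 + degree p2 = Suc (degree F + degree G)"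
    using pq(1) by (intro degree_L) (auto intro: graft.IH)
  moreover have "degree q1 + degree q2 = degree H"
    using pq(2) graft.IH(3) by simp
  ultimately show ?case
    using pq(3) by simp
qed

section \<open>The antipode of a connected graded bialgebra\<close>

context bialgebra
begin

text \<open>
  The convolution product of linear maps. The formula uses the values at basis vectors only; it equals
  the composite of \<open>\<Delta>\<close>, \<open>f \<otimes> g\<close> and the multiplication, by \<open>mult_map_tensor_map\<close>.
\<close>

definition convolution ::
    "(('b \<Rightarrow>\<^sub>0 'k) \<Rightarrow> ('b \<Rightarrow>\<^sub>0 'k)) \<Rightarrow> (('b \<Rightarrow>\<^sub>0 'k) \<Rightarrow> ('b \<Rightarrow>\<^sub>0 'k)) \<Rightarrow> ('b \<Rightarrow>\<^sub>0 'k) \<Rightarrow> ('b \<Rightarrow>\<^sub>0 'k)"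
  where "convolution f g x = lin_ext (\<lambda>(a, b). mult (f (bv a)) (g (bv b))) (\<Delta> x)"

definition unit_counit :: "('b \<Rightarrow>\<^sub>0 'k) \<Rightarrow> ('b \<Rightarrow>\<^sub>0 'k)" where
  "unit_counit x = scale (\<epsilon> x) one"

lemmas mult_simps = linear_simps[OF mult_linear_left] linear_simps[OF mult_linear_right]

lemmas comult_simps = linear_simps[OF comult_linear]

lemma counit_simps: "\<epsilon> (x + y) = \<epsilon> x + \<epsilon> y" "\<epsilon> (scale c x) = c * \<epsilon> x"
  using counit_linear by (simp_all add: Vector_Spaces.linear_def module_hom_def module_hom_axioms_def)

lemma linear_unit_counit: "Vector_Spaces.linear scale scale unit_counit"
  by (simp add: linear_scale_iff unit_counit_def counit_simps pm.scale_left_distrib)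

lemma linear_convolution: "Vector_Spaces.linear scale scale (convolution f g)"
  by (simp add: linear_scale_iff convolution_def comult_simps)

lemma mult_map_tensor_map: "mult_map mult (tensor_map f g (\<Delta> x)) = convolution f g x"
proof -
  have tensor: "mult_map mult (x \<otimes> y) = mult x y" for x y
  proof (induction x rule: bv_induct)
    case (bv a)
    show ?case
      by (induction y rule: bv_induct) (simp_all add: mult_map_def mult_simps)
  qed (simp_all add: mult_map_def mult_simps)
  have "mult_map mult (tensor_map f g u) = lin_ext (\<lambda>(a, b). mult (f (bv a)) (g (bv b))) u" for u
  proof (induction u rule: bv_induct)
    case (bv p)
    show ?case
      by (cases p) (simp add: tensor_map_def tensor)
  qed (simp_all add: mult_map_def tensor_map_def)
  then show ?thesis
    by (simp add: convolution_def)
qed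

lemma convolution_add_left: "convolution (\<lambda>x. f x + g x) h x = convolution f h x + convolution g h x"
  by (simp add: convolution_def case_prod_unfold mult_simps)

lemma convolution_add_right: "convolution h (\<lambda>x. f x + g x) x = convolution h f x + convolution h g x"
  by (simp add: convolution_def case_prod_unfold mult_simps)

lemma convolution_sum_left: "convolution (\<lambda>x. \<Sum>k\<le>n. f k x) h x = (\<Sum>k\<le>n. convolution (f k) h x)" for n :: nat
  by (induction n) (simp_all add: convolution_add_left)

lemma convolution_sum_right: "convolution h (\<lambda>x. \<Sum>k\<le>n. f k x) x = (\<Sum>k\<le>n. convolution h (f k) x)" for n :: nat
  by (induction n) (simp_all add: convolution_add_right)

lemma convolution_unit_left:
  assumes f: "Vector_Spaces.linear scale scale f"
  shows "convolution unit_counit f x = f x"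
proof -
  have "lin_ext (\<lambda>(a, b). mult (unit_counit (bv a)) (f (bv b))) u = f (form_left \<epsilon> u)" for u
    by (induction u rule: bv_induct)
      (auto simp: form_left_def linear_simps[OF f] unit_counit_def mult_simps one_left)
  then show ?thesis
    by (simp add: convolution_def counit_left)
qed

lemma convolution_unit_right:
  assumes f: "Vector_Spaces.linear scale scale f"
  shows "convolution f unit_counit x = f x"
proof -
  have "lin_ext (\<lambda>(a, b). mult (f (bv a)) (unit_counit (bv b))) u = f (form_right \<epsilon> u)" for u
    by (induction u rule: bv_induct)
      (auto simp: form_right_def linear_simps[OF f] unit_counit_def mult_simps one_right)
  then show ?thesis
    by (simp add: convolution_def counit_right)
qed

text \<open>
  Associativity of convolution combines associativity of the product and of the coproduct: both sides
  apply \<open>f \<otimes> g \<otimes> h\<close>, followed by the triple product, to the iterated coproduct.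
\<close>

lemma convolution_assoc: "convolution (convolution f g) h x = convolution f (convolution g h) x"
proof -
  define T :: "('b \<times> 'b \<times> 'b \<Rightarrow>\<^sub>0 'k) \<Rightarrow> ('b \<Rightarrow>\<^sub>0 'k)"
    where "T = lin_ext (\<lambda>(a, b, c). mult (f (bv a)) (mult (g (bv b)) (h (bv c))))"
  have left: "T (tensor_assoc (p \<otimes> bv b))
      = mult (lin_ext (\<lambda>(a, b). mult (f (bv a)) (g (bv b))) p) (h (bv b))" for p b
    by (induction p rule: bv_induct)
      (auto simp: T_def tensor_assoc_def mult_simps mult_assoc)
  have right: "T (bv a \<otimes> p) = mult (f (bv a)) (lin_ext (\<lambda>(a, b). mult (g (bv a)) (h (bv b))) p)" for p a
    by (induction p rule: bv_induct) (auto simp: T_def mult_simps)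
  have "lin_ext (\<lambda>(a, b). mult (convolution f g (bv a)) (h (bv b))) u = T (tensor_assoc (tensor_map \<Delta> id u))" for u
  proof (induction u rule: bv_induct)
    case (bv p)
    show ?case
      by (cases p) (simp add: tensor_map_def left convolution_def)
  qed (simp_all add: T_def tensor_assoc_def tensor_map_def)
  moreover have "lin_ext (\<lambda>(a, b). mult (f (bv a)) (convolution g h (bv b))) u = T (tensor_map id \<Delta> u)" for u
  proof (induction u rule: bv_induct)
    case (bv p)
    show ?case
      by (cases p) (simp add: tensor_map_def right convolution_def)
  qed (simp_all add: T_def tensor_map_def)
  ultimately show ?thesis
    by (simp add: convolution_def[of "convolution f g"] convolution_def[of _ "convolution g h"] coassoc)
qed

text \<open>
  The convolution powers of \<open>\<eta>\<epsilon> - id\<close>, where \<open>\<eta>\<epsilon>\<close> is the unit of convolution. They are the terms of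
  the geometric series for the convolution inverse of \<open>id = \<eta>\<epsilon> - (\<eta>\<epsilon> - id)\<close>.
\<close>

fun defect_power :: "nat \<Rightarrow> ('b \<Rightarrow>\<^sub>0 'k) \<Rightarrow> ('b \<Rightarrow>\<^sub>0 'k)" where
  "defect_power 0 = unit_counit"
| "defect_power (Suc k) = convolution (\<lambda>x. unit_counit x - x) (defect_power k)"

lemma linear_defect: "Vector_Spaces.linear scale scale (\<lambda>x. unit_counit x - x)"
  by (simp add: linear_scale_iff linear_simps[OF linear_unit_counit] pm.scale_right_diff_distrib)

lemma linear_defect_power: "Vector_Spaces.linear scale scale (defect_power k)"
  by (cases k) (simp_all add: linear_unit_counit linear_convolution)

lemma defect_power_Suc_right: "defect_power (Suc k) = convolution (defect_power k) (\<lambda>x. unit_counit x - x)"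
proof (induction k)
  case 0
  show ?case
    by (simp add: fun_eq_iff convolution_unit_left convolution_unit_right linear_defect)
next
  case (Suc k)
  have "defect_power (Suc (Suc k))
      = convolution (\<lambda>x. unit_counit x - x) (convolution (defect_power k) (\<lambda>x. unit_counit x - x))"
    by (subst defect_power.simps(2)) (simp only: Suc)
  also have "\<dots> = convolution (defect_power (Suc k)) (\<lambda>x. unit_counit x - x)"
    by (simp add: fun_eq_iff convolution_assoc)
  finally show ?case .
qed

text \<open>
  The telescoping identity for a partial sum of the geometric series. Convolution with \<open>\<eta>\<epsilon>\<close> splits
  into convolutions with \<open>id\<close> and with \<open>\<eta>\<epsilon> - id\<close>, and the latter shifts the powers by one.
\<close>

lemma geometric_series_inverse:
  shows "convolution (\<lambda>x. \<Sum>k\<le>n. defect_power k x) id x = unit_counit x - defect_power (Suc n) x" (is ?left)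
    and "convolution id (\<lambda>x. \<Sum>k\<le>n. defect_power k x) x = unit_counit x - defect_power (Suc n) x" (is ?right)
proof -
  let ?S = "\<lambda>x. \<Sum>k\<le>n. defect_power k x"
  have S: "Vector_Spaces.linear scale scale ?S"
    by (simp add: linear_scale_iff linear_simps[OF linear_defect_power] sum.distrib pm.scale_sum_right)
  have unit: "unit_counit = (\<lambda>x. id x + (unit_counit x - x))"
    by simp
  have shift: "unit_counit x + (\<Sum>k\<le>n. defect_power (Suc k) x) = ?S x + defect_power (Suc n) x"
    using sum.atMost_Suc_shift[of "\<lambda>k. defect_power k x" n] by simp
  have "?S x = convolution ?S unit_counit x"
    by (simp add: convolution_unit_right[OF S])
  also have "\<dots> = convolution ?S id x + (\<Sum>k\<le>n. defect_power (Suc k) x)"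
    by (subst unit) (simp only: convolution_add_right convolution_sum_left defect_power_Suc_right)
  finally show ?left
    using shift by (simp add: algebra_simps)
  have "?S x = convolution unit_counit ?S x"
    by (simp add: convolution_unit_left[OF S])
  also have "\<dots> = convolution id ?S x + (\<Sum>k\<le>n. defect_power (Suc k) x)"
    by (subst unit) (simp only: convolution_add_left convolution_sum_right defect_power.simps(2))
  finally show ?right
    using shift by (simp add: algebra_simps)
qed

end

text \<open>
  A bialgebra graded by a degree on the basis. Connectedness says that a basis vector of degree 0 is a
  multiple of the unit; it is phrased as \<open>\<eta>\<epsilon> = id\<close> in degree 0 because that is where \<open>\<eta>\<epsilon> - id\<close> has to
  vanish.
\<close>

locale connected_graded_bialgebra =
  bialgebra mult one \<Delta> \<epsilon>
  for mult :: "('b \<Rightarrow>\<^sub>0 'k::field) \<Rightarrow> ('b \<Rightarrow>\<^sub>0 'k) \<Rightarrow> ('b \<Rightarrow>\<^sub>0 'k)" and one \<Delta> \<epsilon> +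
  fixes d :: "'b \<Rightarrow> nat"
  assumes mult_degree: "c \<in> Poly_Mapping.keys (mult (bv a) (bv b)) \<Longrightarrow> d c = d a + d b"
    and comult_degree: "(a, b) \<in> Poly_Mapping.keys (\<Delta> (bv c)) \<Longrightarrow> d a + d b = d c"
    and counit_degree: "d b > 0 \<Longrightarrow> \<epsilon> (bv b) = 0"
    and connected: "d b = 0 \<Longrightarrow> scale (\<epsilon> (bv b)) one = bv b"
begin

text \<open>
  Each factor \<open>\<eta>\<epsilon> - id\<close> kills degree 0 and therefore consumes at least one unit of degree, so the
  geometric series is a finite sum on each element.
\<close>

lemma defect_power_eq_0: "d b < k \<Longrightarrow> defect_power k (bv b) = 0"
proof (induction k arbitrary: b)
  case (Suc k)
  have "(case p of (a, c) \<Rightarrow> mult (unit_counit (bv a) - bv a) (defect_power k (bv c))) = 0"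
    if "p \<in> Poly_Mapping.keys (\<Delta> (bv b))" for p
  proof -
    \<comment> \<open>If the left factor has positive degree, the right one has degree less than \<open>k\<close>.\<close>
    obtain a c where p: "p = (a, c)" by force
    then have "d a = 0 \<or> d c < k"
      using comult_degree[of a c b] that Suc.prems by auto
    then show ?thesis
      using Suc.IH[of c] connected[of a] by (auto simp: p unit_counit_def mult_simps)
  qed
  then have "defect_power (Suc k) (bv b) = lin_ext (\<lambda>_. 0) (\<Delta> (bv b))"
    unfolding defect_power.simps convolution_def by (rule lin_ext_cong)
  then show ?case
    by simp
qed simp

lemma degree_mult:
  assumes "c \<in> Poly_Mapping.keys (mult x y)"
    and x: "\<And>a. a \<in> Poly_Mapping.keys x \<Longrightarrow> d a = m" and y: "\<And>b. b \<in> Poly_Mapping.keys y \<Longrightarrow> d b = n"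
  shows "d c = m + n"
proof -
  have "mult x y = lin_ext (\<lambda>a. mult (bv a) y) x"
    by (rule fun_cong[OF linear_eq_lin_ext[OF mult_linear_left]])
  with assms(1) obtain a where a: "a \<in> Poly_Mapping.keys x" "c \<in> Poly_Mapping.keys (mult (bv a) y)"
    using keys_lin_ext[of "\<lambda>a. mult (bv a) y" x] by auto
  have "mult (bv a) y = lin_ext (\<lambda>b. mult (bv a) (bv b)) y"
    by (rule fun_cong[OF linear_eq_lin_ext[OF mult_linear_right]])
  with a(2) obtain b where "b \<in> Poly_Mapping.keys y" "c \<in> Poly_Mapping.keys (mult (bv a) (bv b))"
    using keys_lin_ext[of "\<lambda>b. mult (bv a) (bv b)" y] by auto
  then show ?thesis
    using mult_degree x y a(1) by metis
qed

lemma degree_unit_counit: "c \<in> Poly_Mapping.keys (unit_counit (bv b)) \<Longrightarrow> d c = d b"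
  using connected[of b] counit_degree[of b] by (cases "d b = 0") (simp_all add: unit_counit_def)

lemma degree_defect_power: "c \<in> Poly_Mapping.keys (defect_power k (bv b)) \<Longrightarrow> d c = d b"
proof (induction k arbitrary: b c)
  case (Suc k)
  then obtain p where p: "p \<in> Poly_Mapping.keys (\<Delta> (bv b))"
    "c \<in> Poly_Mapping.keys (case p of (a, e) \<Rightarrow> mult (unit_counit (bv a) - bv a) (defect_power k (bv e)))"
    using keys_lin_ext unfolding defect_power.simps convolution_def by fastforce
  obtain a e where ae: "p = (a, e)" by force
  have "d c = d a + d e"
  proof (rule degree_mult)
    show "c \<in> Poly_Mapping.keys (mult (unit_counit (bv a) - bv a) (defect_power k (bv e)))"
      using p(2) by (simp add: ae)
    show "d b = d a" if "b \<in> Poly_Mapping.keys (unit_counit (bv a) - bv a)" for b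
      using that degree_unit_counit[of b a]
      by (auto simp: in_keys_iff lookup_minus lookup_single when_def split: if_splits)
  qed (rule Suc.IH)
  then show ?case
    using comult_degree[of a e b] p(1) ae by simp
qed (simp add: degree_unit_counit)

text \<open>
  The geometric series, cut off at the degree of the basis vector, beyond which its terms vanish.
\<close>

definition antipode_series :: "('b \<Rightarrow>\<^sub>0 'k) \<Rightarrow> ('b \<Rightarrow>\<^sub>0 'k)" where
  "antipode_series = lin_ext (\<lambda>b. \<Sum>k\<le>d b. defect_power k (bv b))"

lemma antipode_series_truncate: "d b \<le> n \<Longrightarrow> antipode_series (bv b) = (\<Sum>k\<le>n. defect_power k (bv b))"
  unfolding antipode_series_def lin_ext_bv
  by (rule sum.mono_neutral_left) (auto simp: defect_power_eq_0)

text \<open>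
  The coproduct of a basis vector of degree \<open>n\<close> involves degrees at most \<open>n\<close>, where the series may be
  replaced by its partial sum up to \<open>n\<close>; the remainder of that partial sum is a power that vanishes in
  degree \<open>n\<close>.
\<close>

lemma antipode_antipode_series: "antipode antipode_series"
proof -
  have S: "Vector_Spaces.linear scale scale antipode_series"
    unfolding antipode_series_def by (rule linear_lin_ext)
  have left: "convolution antipode_series id (bv b) = unit_counit (bv b)" for b
  proof -
    have "convolution antipode_series id (bv b) = convolution (\<lambda>x. \<Sum>k\<le>d b. defect_power k x) id (bv b)"
      unfolding convolution_def
      by (rule lin_ext_cong) (use comult_degree[of _ _ b] in \<open>force simp: antipode_series_truncate[of _ "d b"]\<close>)
    then show ?thesis
      unfolding geometric_series_inverse by (simp add: defect_power_eq_0 del: defect_power.simps)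
  qed
  have right: "convolution id antipode_series (bv b) = unit_counit (bv b)" for b
  proof -
    have "convolution id antipode_series (bv b) = convolution id (\<lambda>x. \<Sum>k\<le>d b. defect_power k x) (bv b)"
      unfolding convolution_def
      by (rule lin_ext_cong) (use comult_degree[of _ _ b] in \<open>force simp: antipode_series_truncate[of _ "d b"]\<close>)
    then show ?thesis
      unfolding geometric_series_inverse by (simp add: defect_power_eq_0 del: defect_power.simps)
  qed
  have "convolution antipode_series id x = unit_counit x" "convolution id antipode_series x = unit_counit x" for x
    by (rule linear_eqI[OF linear_convolution linear_unit_counit], rule left right)+
  then show ?thesis
    using S by (simp add: antipode_def mult_map_tensor_map unit_counit_def)
qed

lemma degree_antipode_series:
  assumes "\<And>b. b \<in> Poly_Mapping.keys x \<Longrightarrow> d b = n" and "c \<in> Poly_Mapping.keys (antipode_series x)"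
  shows "d c = n"
proof -
  obtain b where b: "b \<in> Poly_Mapping.keys x" "c \<in> Poly_Mapping.keys (\<Sum>k\<le>d b. defect_power k (bv b))"
    using assms(2) keys_lin_ext unfolding antipode_series_def by fastforce
  then obtain k where "c \<in> Poly_Mapping.keys (defect_power k (bv b))"
    using keys_sum by fastforce
  then show ?thesis
    using assms(1) b(1) degree_defect_power by metis
qed

end

section \<open>Gradings by a degree on the basis\<close>

text \<open>
  The homogeneous components are the restrictions to the basis vectors of a given degree; a
  coefficient at \<open>b\<close> can only come from the component of degree \<open>d b\<close>, which gives uniqueness.
\<close>

lemma vs_grading_keys: "vs_grading (\<lambda>n. {x :: 'b \<Rightarrow>\<^sub>0 'k::field. \<forall>b\<in>Poly_Mapping.keys x. d b = n})"
  unfolding vs_grading_def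
proof (intro conjI allI)
  show "pm.subspace {x :: 'b \<Rightarrow>\<^sub>0 'k. \<forall>b\<in>Poly_Mapping.keys x. d b = n}" for n :: nat
    unfolding span_bv[symmetric] by (rule pm.subspace_span)
  fix x :: "'b \<Rightarrow>\<^sub>0 'k"
  define c where "c n = lin_ext (\<lambda>b. if d b = n then bv b else 0) x" for n
  have lookup_lin_ext: "Poly_Mapping.lookup (lin_ext f x) b
      = (\<Sum>a\<in>Poly_Mapping.keys x. Poly_Mapping.lookup x a * Poly_Mapping.lookup (f a) b)" for f b
    by (simp add: lin_ext_def lookup_sum)
  have lookup_c: "Poly_Mapping.lookup (c n) b = (if d b = n then Poly_Mapping.lookup x b else 0)" for n b
  proof -
    have "Poly_Mapping.lookup (c n) b
        = (\<Sum>a\<in>Poly_Mapping.keys x. if a = b then (if d b = n then Poly_Mapping.lookup x b else 0) else 0)"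
      unfolding c_def lookup_lin_ext by (rule sum.cong) (auto simp: lookup_single when_def)
    then show ?thesis
      by (simp add: in_keys_iff)
  qed
  have support: "{n. c n \<noteq> 0} \<subseteq> d ` Poly_Mapping.keys x"
    by (auto simp: poly_mapping_eq_iff fun_eq_iff lookup_c in_keys_iff split: if_splits)
  have finite: "finite {n. c n \<noteq> 0}"
    by (rule finite_subset[OF support]) simp
  have off_degree: "Poly_Mapping.lookup (e n) b = 0"
    if "\<forall>n. e n \<in> {x. \<forall>b\<in>Poly_Mapping.keys x. d b = n}" "n \<noteq> d b" for e :: "nat \<Rightarrow> 'b \<Rightarrow>\<^sub>0 'k" and n b
  proof (rule ccontr)
    assume "Poly_Mapping.lookup (e n) b \<noteq> 0"
    then have "b \<in> Poly_Mapping.keys (e n)"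
      by (simp add: in_keys_iff)
    with that show False
      by auto
  qed
  have lookup_sum_eq: "Poly_Mapping.lookup (\<Sum>n | e n \<noteq> 0. e n) b = Poly_Mapping.lookup (e (d b)) b"
    if "\<forall>n. e n \<in> {x. \<forall>b\<in>Poly_Mapping.keys x. d b = n}" "finite {n. e n \<noteq> 0}" for e :: "nat \<Rightarrow> 'b \<Rightarrow>\<^sub>0 'k" and b
  proof -
    have "Poly_Mapping.lookup (\<Sum>n | e n \<noteq> 0. e n) b
        = (\<Sum>n | e n \<noteq> 0. if n = d b then Poly_Mapping.lookup (e (d b)) b else 0)"
      unfolding lookup_sum using off_degree[of e _ b] that(1) by (intro sum.cong) auto
    then show ?thesis
      using that(2) by simp
  qed
  show "\<exists>!c. (\<forall>n. c n \<in> {x. \<forall>b\<in>Poly_Mapping.keys x. d b = n}) \<and> finite {n. c n \<noteq> 0} \<and> x = (\<Sum>n | c n \<noteq> 0. c n)"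
  proof (intro ex1I[of _ c] conjI allI)
    show c_mem: "c n \<in> {x. \<forall>b\<in>Poly_Mapping.keys x. d b = n}" for n
      by (auto simp: in_keys_iff lookup_c split: if_splits)
    show "x = (\<Sum>n | c n \<noteq> 0. c n)"
      using lookup_sum_eq[of c] c_mem finite by (simp add: poly_mapping_eq_iff fun_eq_iff lookup_c)
  next
    fix e
    assume e: "(\<forall>n. e n \<in> {x. \<forall>b\<in>Poly_Mapping.keys x. d b = n}) \<and> finite {n. e n \<noteq> 0} \<and> x = (\<Sum>n | e n \<noteq> 0. e n)"
    then have x: "Poly_Mapping.lookup x b = Poly_Mapping.lookup (e (d b)) b" for b
      using lookup_sum_eq[of e b] by simp
    have "Poly_Mapping.lookup (e n) b = Poly_Mapping.lookup (c n) b" for n b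
      using e x[of b] off_degree[of e n b] by (auto simp: lookup_c)
    then show "e = c"
      by (simp add: fun_eq_iff poly_mapping_eq_iff)
  qed (rule finite)
qed

section \<open>The Hopf algebra of forests\<close>

lemma homogeneous_iff: "x \<in> homogeneous n \<longleftrightarrow> (\<forall>F\<in>Poly_Mapping.keys x. degree F = n)"
  by (simp add: homogeneous_def span_bv)

lemma degree_times:
  assumes "F \<in> Poly_Mapping.keys (x * y)" "x \<in> homogeneous m" "y \<in> homogeneous n"
  shows "degree F = m + n"
  using assms keys_mult[of x y] by (fastforce simp: homogeneous_iff)

lemma bialgebra_coproduct: "bialgebra (*) 1 (coproduct :: (forest \<Rightarrow>\<^sub>0 'k::field) \<Rightarrow> _) counit"
proof -
  interpret scalars: vector_space "(*) :: 'k \<Rightarrow> 'k \<Rightarrow> 'k"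
    by unfold_locales (simp_all add: algebra_simps)
  have counit: "Vector_Spaces.linear scale (*) (counit :: (forest \<Rightarrow>\<^sub>0 'k) \<Rightarrow> 'k)"
    by (simp add: Vector_Spaces.linear_def module_hom_def module_hom_axioms_def pm.vector_space_axioms
        pm.module_axioms scalars.vector_space_axioms scalars.module_axioms)
  interpret unital_algebra "(*) :: (forest \<Rightarrow>\<^sub>0 'k) \<Rightarrow> _" 1
    by (rule unital_algebra_monoid_algebra)
  show ?thesis
    by unfold_locales
      (simp_all add: linear_coproduct counit coproduct_coassoc coproduct_counit_left coproduct_counit_right
        tensor_mult_monoid_algebra one_tensor_one coproduct_morphism counit_mult del: single_one)
qed

lemma connected_graded_coproduct:
  "connected_graded_bialgebra (*) 1 (coproduct :: (forest \<Rightarrow>\<^sub>0 'k::field) \<Rightarrow> _) counit degree"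
proof -
  interpret bialgebra "(*)" 1 "coproduct :: (forest \<Rightarrow>\<^sub>0 'k) \<Rightarrow> _" counit
    by (rule bialgebra_coproduct)
  show ?thesis
    by unfold_locales (auto simp: mult_single degree_coproduct)
qed

lemma coproduct_homogeneous:
  assumes "x \<in> homogeneous n"
  shows "coproduct x \<in> pm.span {y \<otimes> z |y z. \<exists>i j. i + j = n \<and> y \<in> homogeneous i \<and> z \<in> homogeneous j}"
proof -
  have "degree a + degree b = n" if ab: "(a, b) \<in> Poly_Mapping.keys (coproduct x)" for a b
  proof -
    have "coproduct x = lin_ext (\<lambda>F. coproduct (bv F)) x"
      by (rule fun_cong[OF linear_eq_lin_ext[OF linear_coproduct]])
    with ab obtain F where "F \<in> Poly_Mapping.keys x"
        "(a, b) \<in> Poly_Mapping.keys (coproduct (bv F) :: _ \<Rightarrow>\<^sub>0 'a)"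
      using keys_lin_ext[of "\<lambda>F. coproduct (bv F)" x] by auto
    then show ?thesis
      using assms degree_coproduct by (fastforce simp: homogeneous_iff)
  qed
  then have "coproduct x \<in> pm.span {bv p |p. degree (fst p) + degree (snd p) = n}"
    unfolding span_bv by auto
  moreover have "{bv p |p. degree (fst p) + degree (snd p) = n}
      \<subseteq> {y \<otimes> z |y z. \<exists>i j. i + j = n \<and> y \<in> homogeneous i \<and> (z :: _ \<Rightarrow>\<^sub>0 'a) \<in> homogeneous j}"
  proof safe
    fix a b
    show "\<exists>y z. bv (a, b) = y \<otimes> z \<and>
        (\<exists>i j. i + j = degree (fst (a, b)) + degree (snd (a, b)) \<and> y \<in> homogeneous i \<and> (z :: _ \<Rightarrow>\<^sub>0 'a) \<in> homogeneous j)"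
      by (intro exI[of _ "bv a"] exI[of _ "bv b"]) (auto simp: homogeneous_iff simp del: single_one)
  qed
  ultimately show ?thesis
    using pm.span_mono by blast
qed

theorem theorem20:
  shows "(\<exists>!\<Delta> :: (forest \<Rightarrow>\<^sub>0 'k::field) \<Rightarrow> (forest \<times> forest \<Rightarrow>\<^sub>0 'k). is_coproduct \<Delta>) \<and>
    graded_connected_hopf_algebra (*) 1
      (coproduct :: (forest \<Rightarrow>\<^sub>0 'k) \<Rightarrow> (forest \<times> forest \<Rightarrow>\<^sub>0 'k)) counit homogeneous"
proof (rule conjI[OF ex1_coproduct])
  interpret connected_graded_bialgebra "(*)" 1 "coproduct :: (forest \<Rightarrow>\<^sub>0 'k) \<Rightarrow> _" counit degree
    by (rule connected_graded_coproduct)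
  show "graded_connected_hopf_algebra (*) 1
      (coproduct :: (forest \<Rightarrow>\<^sub>0 'k) \<Rightarrow> (forest \<times> forest \<Rightarrow>\<^sub>0 'k)) counit homogeneous"
  proof unfold_locales
    show "\<exists>S. antipode S"
      using antipode_antipode_series by blast
    show "vs_grading (homogeneous :: nat \<Rightarrow> (forest \<Rightarrow>\<^sub>0 'k) set)"
      using vs_grading_keys[of degree] by (simp add: homogeneous_def[abs_def] span_bv)
    show "(1 :: forest \<Rightarrow>\<^sub>0 'k) \<in> homogeneous 0"
      by (simp add: homogeneous_iff)
    show "x * y \<in> homogeneous (m + n)" if "x \<in> homogeneous m" "y \<in> homogeneous n" for x y :: "forest \<Rightarrow>\<^sub>0 'k" and m n
      unfolding homogeneous_iff[of "x * y"] using degree_times that by blast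
    show "counit x = 0" if "n > 0" "x \<in> homogeneous n" for n and x :: "forest \<Rightarrow>\<^sub>0 'k"
      using that by (force simp: homogeneous_iff counit_def intro!: sum.neutral)
    show "coproduct x \<in> pm.span {y \<otimes> z |y z. \<exists>i j. i + j = n \<and> y \<in> homogeneous i \<and> z \<in> homogeneous j}"
      if "x \<in> homogeneous n" for x :: "forest \<Rightarrow>\<^sub>0 'k" and n
      using that by (rule coproduct_homogeneous)
    show "\<exists>S. antipode S \<and> (\<forall>n. \<forall>x\<in>homogeneous n. S x \<in> homogeneous n)"
    proof (intro exI[of _ antipode_series] conjI allI ballI antipode_antipode_series)
      show "antipode_series x \<in> homogeneous n" if "x \<in> homogeneous n" for n x
        using that degree_antipode_series[of x n] by (simp add: homogeneous_iff)
    qed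
    have "homogeneous 0 = pm.span {1 :: forest \<Rightarrow>\<^sub>0 'k}"
      by (simp add: homogeneous_def)
    then show "pm.dim (homogeneous 0 :: (forest \<Rightarrow>\<^sub>0 'k) set) = 1"
      by (simp add: pm.dim_span pm.dim_eq_card_independent)
  qed
qed

end
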